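(* Let $N\geq 1$ be an integer. Then for all $0<t<\pi/2$, \[ \lambda_N t^{2N+2}<\left(\frac{t}{\sin t}\right)^2+\frac{t}{\tan t}-\left(2+\sum_{j=1}^{N-1}\frac{j\cdot 2^{2j+3}|B_{2j+2}|}{(2j+2)!}t^{2j+2}\right)<\mu_N t^{2N+2}, \] where \[ \lambda_N=\frac{N\cdot 2^{2N+3}|B_{2N+2}|}{(2N+2)!},\qquad \mu_N=\frac{64N}{\pi^{2N+2}}\sum_{k=1}^{\infty}\frac{1}{k^{2N-2}(4k^2-1)^2}-\frac{16(N-1)}{\pi^{2N+2}}\sum_{k=1}^{\infty}\frac{1}{k^{2N}(4k^2-1)^2}, \] and these constants are best possible (i.e. $\lambda_N$ is the largest and $\mu_N$ the smallest constant for which the respective inequality holds on $(0,\pi/2)$).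
   Context: The Bernoulli numbers $B_n$ are defined by $\frac{t}{e^t-1}=\sum_{n=0}^\infty B_n\frac{t^n}{n!}$ for $|t|<2\pi$. An empty sum is understood to be zero. *)

theory Defs
  imports "HOL-Analysis.Analysis" "HOL-Computational_Algebra.Formal_Power_Series"
begin

definition bernoulli :: "nat \<Rightarrow> real" where
  "bernoulli n = fact n * fps_nth (fps_X / (fps_exp 1 - 1)) n"

definition F_N :: "nat \<Rightarrow> real \<Rightarrow> real" where
  "F_N N t = (t / sin t)^2 + t / tan t
     - (2 + (\<Sum>j=1..N-1. real j * 2^(2*j+3) * \<bar>bernoulli (2*j+2)\<bar> / fact (2*j+2) * t^(2*j+2)))"

definition lambda_N :: "nat \<Rightarrow> real" where
  "lambda_N N = real N * 2^(2*N+3) * \<bar>bernoulli (2*N+2)\<bar> / fact (2*N+2)"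

definition mu_N :: "nat \<Rightarrow> real" where
  "mu_N N = 64 * real N / pi^(2*N+2) * (\<Sum>k. 1 / (real (Suc k)^(2*N-2) * (4 * real (Suc k)^2 - 1)^2))
          - 16 * (real N - 1) / pi^(2*N+2) * (\<Sum>k. 1 / (real (Suc k)^(2*N) * (4 * real (Suc k)^2 - 1)^2))"

end

theory Submission
  imports Defs
begin

text \<open>Write \<open>t = \<pi> x\<close> with \<open>0 < x < 1\<close> and \<open>u\<^sub>k = x\<^sup>2/(k + 1)\<^sup>2\<close>. The partial fraction
  expansions of \<open>cot\<close> and \<open>csc\<^sup>2\<close> give \<open>(t/sin t)\<^sup>2 + t/tan t - 2 = \<Sum>\<^sub>k 4u\<^sub>k\<^sup>2/(1 - u\<^sub>k)\<^sup>2\<close>.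
  Expanding \<open>4u\<^sup>2/(1 - u)\<^sup>2 = \<Sum>\<^sub>j\<^sub>\<ge>\<^sub>1 4j u\<^bsup>j+1\<^esup>\<close> and summing over \<open>k\<close> produces the coefficients
  \<open>4j \<zeta>(2j+2)/\<pi>\<^bsup>2j+2\<^esup>\<close>, which by Euler's formula for \<open>\<zeta>(2m)\<close> are exactly the coefficients of the
  subtracted polynomial. What remains is
  \<open>F\<^sub>N(\<pi> x)/x\<^bsup>2N+2\<^esup> = \<Sum>\<^sub>k Q\<^sub>N(u\<^sub>k)/(k + 1)\<^bsup>2N+2\<^esup>\<close> with \<open>Q\<^sub>N(u) = 4/(1 - u)\<^sup>2 + 4(N - 1)/(1 - u)\<close>,
  which is strictly increasing in \<open>u\<close> with \<open>Q\<^sub>N(0) = 4N\<close>. So \<open>F\<^sub>N(t)/t\<^bsup>2N+2\<^esup>\<close> increases strictly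
  from its limit \<open>\<lambda>\<^sub>N\<close> at \<open>0\<close> to its value \<open>\<mu>\<^sub>N\<close> at \<open>\<pi>/2\<close>.

  Euler's formula comes from comparing two power series for \<open>t cot t\<close>: the one read off from the
  partial fractions, and the one obtained from \<open>X/2 \<cdot> coth (X/2) = B(X) + X/2\<close> by the substitution
  \<open>X \<mapsto> 2iX\<close>, which is carried out on coefficients: both series solve Riccati equations whose
  coefficient recurrences correspond under that substitution.\<close>

lemma fps_nth_conv_deriv_field:
  fixes f :: "'a :: {real_normed_field,banach} fps"
  assumes "fps_conv_radius f > 0"
  shows   "fps_nth f n = (deriv ^^ n) (eval_fps f) 0 / fact n"
  using assms
proof (induction n arbitrary: f)
  case 0
  thus ?case by (simp add: eval_fps_def)
next
  case (Suc n f)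
  have "(deriv ^^ Suc n) (eval_fps f) 0 = (deriv ^^ n) (deriv (eval_fps f)) 0"
    unfolding funpow_Suc_right o_def ..
  also have "eventually (\<lambda>z::'a. z \<in> eball 0 (fps_conv_radius f)) (nhds 0)"
    using Suc.prems by (intro eventually_nhds_in_open) (auto simp: zero_ereal_def)
  hence "eventually (\<lambda>z. deriv (eval_fps f) z = eval_fps (fps_deriv f) z) (nhds 0)"
    by eventually_elim (simp add: eval_fps_deriv)
  hence "(deriv ^^ n) (deriv (eval_fps f)) 0 = (deriv ^^ n) (eval_fps (fps_deriv f)) 0"
    by (intro higher_deriv_cong_ev refl)
  also have "\<dots> / fact n = fps_nth (fps_deriv f) n"
    using Suc.prems fps_conv_radius_deriv[of f]
    by (intro Suc.IH [symmetric]) auto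
  also have "\<dots> / of_nat (Suc n) = fps_nth f (Suc n)"
    by (simp add: fps_deriv_def del: of_nat_Suc)
  finally show ?case by (simp add: field_split_simps)
qed

lemma has_fps_expansion_unique:
  fixes f :: "'a :: {real_normed_field,banach} \<Rightarrow> 'a"
  assumes "f has_fps_expansion F" "f has_fps_expansion G"
  shows "F = G"
proof (rule fps_ext)
  fix n :: nat
  have "fps_nth F n = (deriv ^^ n) (eval_fps F) 0 / fact n"
    using assms by (intro fps_nth_conv_deriv_field) (auto simp: has_fps_expansion_def)
  also have "(deriv ^^ n) (eval_fps F) 0 = (deriv ^^ n) (eval_fps G) 0"
    using assms by (intro higher_deriv_cong_ev) (auto simp: has_fps_expansion_def elim: eventually_elim2)
  also have "\<dots> / fact n = fps_nth G n"
    using assms by (intro fps_nth_conv_deriv_field [symmetric]) (auto simp: has_fps_expansion_def)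
  finally show "fps_nth F n = fps_nth G n" .
qed

lemma sums_less:
  fixes f g :: "nat \<Rightarrow> real"
  assumes "f sums a" "g sums b" "\<And>k. f k < g k"
  shows "a < b"
proof -
  have d: "(\<lambda>k. g k - f k) sums (b - a)" by (rule sums_diff[OF assms(2,1)])
  have "0 < (\<Sum>k. g k - f k)" by (rule suminf_pos) (use sums_summable[OF d] assms(3) in auto)
  with d show ?thesis by (simp add: sums_iff)
qed

lemma sums_swap_nonneg:
  fixes a :: "nat \<Rightarrow> nat \<Rightarrow> real"
  assumes nonneg: "\<And>k m. a k m \<ge> 0"
    and rows: "\<And>k. (\<lambda>m. a k m) sums r k" and total: "r sums R"
    and cols: "\<And>m. (\<lambda>k. a k m) sums c m"
  shows "c sums R"
proof -
  have rows': "((\<lambda>m. a k m) has_sum r k) UNIV" for k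
    by (rule sums_nonneg_imp_has_sum[OF rows nonneg])
  have "r k \<ge> 0" for k
    using rows[of k] nonneg suminf_nonneg[of "a k"] by (auto simp: sums_iff)
  hence total': "(r has_sum R) UNIV" by (intro sums_nonneg_imp_has_sum[OF total])
  have "(\<lambda>(k,m). a k m) summable_on (UNIV \<times> UNIV)"
    using summable_on_SigmaI[where f = "\<lambda>(k,m). a k m" and A = UNIV and B = "\<lambda>_. UNIV" and g = r]
          rows' total' nonneg by (auto simp: has_sum_imp_summable)
  hence by_rows: "((\<lambda>(k,m). a k m) has_sum R) (UNIV \<times> UNIV)"
    using has_sum_SigmaI[where f = "\<lambda>(k,m). a k m" and A = UNIV and B = "\<lambda>_. UNIV" and g = r]
          rows' total' by auto
  have "((\<lambda>(m,k). a k m) has_sum R) (UNIV \<times> UNIV)"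
    using has_sum_swap[THEN iffD1, OF by_rows] by (simp add: case_prod_unfold)
  moreover have "((\<lambda>k. a k m) has_sum c m) UNIV" for m
    by (rule sums_nonneg_imp_has_sum[OF cols nonneg])
  ultimately have "(c has_sum R) UNIV"
    using has_sum_SigmaD[where f = "\<lambda>(m,k). a k m" and A = UNIV and B = "\<lambda>_. UNIV" and g = c]
    by auto
  thus ?thesis by (rule has_sum_imp_sums)
qed

section \<open>Partial fraction expansions\<close>

lemma Gamma_reflection_real:
  fixes x :: real
  shows "Gamma x * Gamma (1 - x) = pi / sin (pi * x)"
proof -
  have "Gamma (complex_of_real x) * Gamma (1 - complex_of_real x) = of_real pi / sin (of_real pi * of_real x)"
    by (rule Gamma_reflection_complex)
  also have "Gamma (1 - complex_of_real x) = Gamma (complex_of_real (1 - x))" by simp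
  also have "sin (of_real pi * of_real x :: complex) = of_real (sin (pi * x))"
    by (simp flip: sin_of_real)
  finally have "complex_of_real (Gamma x * Gamma (1 - x)) = complex_of_real (pi / sin (pi * x))"
    by (simp only: Gamma_complex_of_real of_real_mult of_real_divide)
  thus ?thesis by (simp only: of_real_eq_iff)
qed

lemma Digamma_reflection_real:
  fixes x :: real
  assumes x: "0 < x" "x < 1"
  shows "Digamma (1 - x) - Digamma x = pi * cos (pi * x) / sin (pi * x)"
proof -
  define h where "h y = ln_Gamma y + ln_Gamma (1 - y) + ln (sin (pi * y))" for y :: real
  have sin_pos: "sin (pi * y) > 0" if "0 < y" "y < 1" for y :: real
    using that by (intro sin_gt_zero) auto
  have h_const: "h y = ln pi" if "y \<in> {0<..<1}" for y
  proof -
    from that have y: "0 < y" "y < 1" by auto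
    have "h y = ln (Gamma y * Gamma (1 - y) * sin (pi * y))"
      using y sin_pos[OF y] by (simp add: h_def ln_Gamma_real_pos ln_mult_pos)
    also have "Gamma y * Gamma (1 - y) * sin (pi * y) = pi"
      using Gamma_reflection_real[of y] sin_pos[OF y] by simp
    finally show ?thesis .
  qed
  have "(h has_field_derivative (Digamma x - Digamma (1 - x) + pi * cos (pi * x) / sin (pi * x))) (at x)"
    unfolding h_def using x sin_pos[OF x]
    by (auto intro!: derivative_eq_intros simp: field_simps)
  moreover have "(h has_field_derivative 0) (at x)"
    by (rule has_field_derivative_transform_within_open[of "\<lambda>_. ln pi" _ _ "{0<..<1}"])
       (use x h_const in auto)
  ultimately have "Digamma x - Digamma (1 - x) + pi * cos (pi * x) / sin (pi * x) = 0"
    by (rule DERIV_unique)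
  thus ?thesis by simp
qed

lemma Polygamma_1_reflection_real:
  fixes x :: real
  assumes x: "0 < x" "x < 1"
  shows "Polygamma 1 x + Polygamma 1 (1 - x) = pi^2 / (sin (pi * x))^2"
proof -
  define h where "h y = Digamma (1 - y) - Digamma y - pi * cos (pi * y) / sin (pi * y)" for y :: real
  have sin_pos: "sin (pi * x) > 0"
    using x by (intro sin_gt_zero) auto
  have not_nonpos_Int: "y \<notin> \<int>\<^sub>\<le>\<^sub>0" if "y > 0" for y :: real
    using that by (auto elim!: nonpos_Ints_cases)
  have sin_squared: "sin (pi * x) * sin (pi * x) = 1 - cos (pi * x) * cos (pi * x)"
    using sin_cos_squared_add[of "pi * x"] unfolding power2_eq_square by linarith
  have "(h has_field_derivative (- Polygamma 1 (1 - x) - Polygamma 1 x + pi^2 / (sin (pi * x))^2)) (at x)"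
    unfolding h_def using x sin_pos not_nonpos_Int[of x] not_nonpos_Int[of "1 - x"]
    by (auto intro!: derivative_eq_intros simp: field_simps power2_eq_square sin_squared)
  moreover have "(h has_field_derivative 0) (at x)"
    by (rule has_field_derivative_transform_within_open[of "\<lambda>_. 0" _ _ "{0<..<1}"])
       (use x Digamma_reflection_real in \<open>auto simp: h_def\<close>)
  ultimately have "- Polygamma 1 (1 - x) - Polygamma 1 x + pi^2 / (sin (pi * x))^2 = 0"
    by (rule DERIV_unique)
  thus ?thesis by simp
qed

lemma cot_partial_fractions:
  fixes x :: real
  assumes x: "0 < x" "x < 1"
  shows "(\<lambda>k. 2 * x^2 / ((real k + 1)^2 - x^2)) sums (1 - pi * x * cos (pi * x) / sin (pi * x))"
proof -
  define S where "S = pi * cos (pi * x) / sin (pi * x)"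
  have "(\<lambda>k. inverse (real (Suc k)) - inverse (x + real k)) sums (Digamma x + euler_mascheroni)"
    using summable_Digamma[of x] x by (simp add: Digamma_def summable_sums)
  moreover have "(\<lambda>k. inverse (real (Suc k)) - inverse ((1 - x) + real k))
      sums (Digamma (1 - x) + euler_mascheroni)"
    using summable_Digamma[of "1 - x"] x by (simp add: Digamma_def summable_sums)
  ultimately have u: "(\<lambda>k. inverse (x + real k) - inverse ((1 - x) + real k)) sums S"
    using sums_diff Digamma_reflection_real[OF x] by (fastforce simp: S_def)
  have "(\<lambda>k. inverse (x + real k)) \<longlonglongrightarrow> 0"
    by (intro tendsto_inverse_0_at_top filterlim_tendsto_add_at_top[OF tendsto_const] filterlim_real_sequentially)
  hence w: "(\<lambda>k. inverse (x + real k) - inverse (x + real (Suc k))) sums inverse x"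
    using telescope_sums' by fastforce
  have "(\<lambda>k. (-x) * ((inverse (x + real k) - inverse ((1 - x) + real k))
                     - (inverse (x + real k) - inverse (x + real (Suc k))))) sums ((-x) * (S - inverse x))"
    by (intro sums_mult sums_diff u w)
  moreover have "(-x) * ((inverse (x + real k) - inverse ((1 - x) + real k))
                     - (inverse (x + real k) - inverse (x + real (Suc k))))
           = 2 * x^2 / ((real k + 1)^2 - x^2)" for k
  proof -
    have "(real k + 1)^2 - x^2 = (x + real (Suc k)) * ((1 - x) + real k)"
      by (simp add: algebra_simps power2_eq_square)
    moreover have "x + real (Suc k) > 0" "(1 - x) + real k > 0"
      using x by auto
    ultimately show ?thesis by (simp add: field_simps power2_eq_square)
  qed
  moreover have "(-x) * (S - inverse x) = 1 - pi * x * cos (pi * x) / sin (pi * x)"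
    using x by (simp add: S_def field_simps)
  ultimately show ?thesis by simp
qed

lemma csc_squared_partial_fractions:
  fixes x :: real
  assumes x: "0 < x" "x < 1"
  shows "(\<lambda>k. x^2 / (x + real k + 1)^2 + x^2 / (real k + 1 - x)^2) sums ((pi * x / sin (pi * x))^2 - 1)"
proof -
  have "(\<lambda>k. inverse ((x + real k)^2)) sums Polygamma 1 x"
    using Polygamma_LIMSEQ[of x 1] x by (simp add: numeral_2_eq_2)
  hence "(\<lambda>k. inverse ((x + real (Suc k))^2)) sums (Polygamma 1 x - inverse (x^2))"
    using sums_Suc_iff[of "\<lambda>k. inverse ((x + real k)^2)"] by simp
  moreover have "(\<lambda>k. inverse (((1 - x) + real k)^2)) sums Polygamma 1 (1 - x)"
    using Polygamma_LIMSEQ[of "1 - x" 1] x by (simp add: numeral_2_eq_2)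
  ultimately have "(\<lambda>k. x^2 * (inverse ((x + real (Suc k))^2) + inverse (((1 - x) + real k)^2)))
       sums (x^2 * (Polygamma 1 x - inverse (x^2) + Polygamma 1 (1 - x)))"
    by (intro sums_mult sums_add)
  moreover have "x^2 * (Polygamma 1 x - inverse (x^2) + Polygamma 1 (1 - x))
      = x^2 * (Polygamma 1 x + Polygamma 1 (1 - x)) - 1"
    using x by (simp add: field_simps)
  moreover have "x^2 * (Polygamma 1 x + Polygamma 1 (1 - x)) = (pi * x / sin (pi * x))^2"
    by (simp only: Polygamma_1_reflection_real[OF x]) (simp add: power_divide power_mult_distrib)
  moreover have "x^2 * (inverse ((x + real (Suc k))^2) + inverse (((1 - x) + real k)^2))
      = x^2 / (x + real k + 1)^2 + x^2 / (real k + 1 - x)^2" for k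
    by (simp add: field_simps add_ac diff_add_eq)
  ultimately show ?thesis by simp
qed

lemma csc_squared_plus_cot_sums:
  fixes x :: real
  assumes x: "0 < x" "x < 1"
  shows "(\<lambda>k. 4 * x^4 / ((real k + 1)^2 - x^2)^2) sums ((pi * x / sin (pi * x))^2 + pi * x / tan (pi * x) - 2)"
proof -
  have "(\<lambda>k. (x^2 / (x + real k + 1)^2 + x^2 / (real k + 1 - x)^2) - 2 * x^2 / ((real k + 1)^2 - x^2))
     sums (((pi * x / sin (pi * x))^2 - 1) - (1 - pi * x * cos (pi * x) / sin (pi * x)))"
    by (rule sums_diff[OF csc_squared_partial_fractions[OF x] cot_partial_fractions[OF x]])
  moreover have "(x^2 / (x + real k + 1)^2 + x^2 / (real k + 1 - x)^2) - 2 * x^2 / ((real k + 1)^2 - x^2)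
          = 4 * x^4 / ((real k + 1)^2 - x^2)^2" for k
  proof -
    define p where "p = x + real k + 1"
    define q where "q = real k + 1 - x"
    have "p > 0" "q > 0" using x by (auto simp: p_def q_def)
    hence "x^2 / p^2 + x^2 / q^2 - 2 * x^2 / (p * q) = x^2 * (q - p)^2 / (p * q)^2"
      by (simp add: field_simps power2_eq_square)
    also have "q - p = -2 * x" by (simp add: p_def q_def)
    finally have "x^2 / p^2 + x^2 / q^2 - 2 * x^2 / (p * q) = 4 * x^4 / (p * q)^2"
      by (simp add: power_mult_distrib power2_eq_square power4_eq_xxxx)
    moreover have "(real k + 1)^2 - x^2 = p * q"
      by (simp add: p_def q_def algebra_simps power2_eq_square)
    ultimately show ?thesis by (simp add: p_def q_def)
  qed
  ultimately show ?thesis by (simp add: tan_def)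
qed

definition zeta :: "nat \<Rightarrow> real" where
  "zeta m = (\<Sum>k. 1 / (real k + 1)^m)"

lemma zeta_sums:
  assumes "m \<ge> 2"
  shows "(\<lambda>k. 1 / (real k + 1)^m) sums zeta m"
proof -
  have "summable (\<lambda>k. inverse (real k ^ m))"
    using inverse_power_summable[of m] assms by simp
  hence "summable (\<lambda>k. inverse (real (k + 1) ^ m))"
    by (rule summable_ignore_initial_segment)
  thus ?thesis by (simp add: zeta_def summable_sums inverse_eq_divide add_ac)
qed

lemma zeta_pos: "m \<ge> 2 \<Longrightarrow> zeta m > 0"
  unfolding zeta_def using zeta_sums by (intro suminf_pos) (auto simp: sums_iff)

lemma scaled_zeta_sums:
  assumes "m \<ge> 1"
  shows "(\<lambda>k. c * (x^2 / (real k + 1)^2)^m) sums (c * zeta (2 * m) * x^(2 * m))"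
proof -
  have "(\<lambda>k. (c * x^(2 * m)) * (1 / (real k + 1)^(2 * m))) sums ((c * x^(2 * m)) * zeta (2 * m))"
    using assms by (intro sums_mult zeta_sums) auto
  moreover have "(x^2 / (real k + 1)^2)^m = x^(2 * m) / (real k + 1)^(2 * m)" for k
    by (simp add: power_mult power_divide)
  ultimately show ?thesis by (simp add: mult_ac)
qed

lemma cot_zeta_sums:
  fixes x :: real
  assumes x: "0 < x" "x < 1"
  shows "(\<lambda>m. 2 * zeta (2 * m + 2) * x^(2 * m + 2)) sums (1 - pi * x * cos (pi * x) / sin (pi * x))"
proof (rule sums_swap_nonneg[where a = "\<lambda>k m. 2 * (x^2 / (real k + 1)^2)^(m + 1)"])
  fix k :: nat
  define u where "u = x^2 / (real k + 1)^2"
  have "x^2 < (real k + 1)^2"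
    using x by (intro power_strict_mono) auto
  hence u: "0 \<le> u" "u < 1"
    by (simp_all add: u_def)
  have "(\<lambda>m. (2 * u) * u^m) sums ((2 * u) * (1 / (1 - u)))"
    using u by (intro sums_mult geometric_sums) auto
  also have "(2 * u) * (1 / (1 - u)) = 2 * x^2 / ((real k + 1)^2 - x^2)"
    using \<open>x^2 < (real k + 1)^2\<close> by (simp add: u_def field_simps)
  finally show "(\<lambda>m. 2 * (x^2 / (real k + 1)^2)^(m + 1)) sums (2 * x^2 / ((real k + 1)^2 - x^2))"
    unfolding u_def[symmetric] by (simp add: mult_ac)
next
  fix m :: nat
  show "(\<lambda>k. 2 * (x^2 / (real k + 1)^2)^(m + 1)) sums (2 * zeta (2 * m + 2) * x^(2 * m + 2))"
    using scaled_zeta_sums[of "m + 1" 2 x] by simp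
qed (use cot_partial_fractions[OF x] in auto)

definition x_cot :: "real \<Rightarrow> real" where
  "x_cot t = (if t = 0 then 1 else t * cos t / sin t)"

definition x_cot_coeff :: "nat \<Rightarrow> real" where
  "x_cot_coeff n = (if n = 0 then 1 else if even n then -2 * zeta n / pi^n else 0)"

lemma x_cot_coeff_sums:
  fixes t :: real
  assumes t: "\<bar>t\<bar> < pi"
  shows "(\<lambda>n. x_cot_coeff n * t^n) sums x_cot t"
proof (cases "t = 0")
  case True
  thus ?thesis using powser_sums_zero[of x_cot_coeff] by (simp add: x_cot_def x_cot_coeff_def)
next
  case False
  define x where "x = \<bar>t\<bar> / pi"
  have x: "0 < x" "x < 1" using t False by (auto simp: x_def field_simps)
  have "pi * x * cos (pi * x) / sin (pi * x) = t * cos t / sin t"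
    using t by (cases "t < 0") (auto simp: x_def)
  moreover have "x^(2 * m + 2) = t^(2 * m + 2) / pi^(2 * m + 2)" for m
    by (simp add: x_def power_divide power_even_abs)
  ultimately have "(\<lambda>m. x_cot_coeff (2 * m + 2) * t^(2 * m + 2)) sums (t * cos t / sin t - 1)"
    using sums_minus[OF cot_zeta_sums[OF x]] by (simp add: x_cot_coeff_def)
  moreover define g where "g n = (if n = 0 then 0 else x_cot_coeff n * t^n)" for n
  ultimately have "(\<lambda>m. g (2 * m + 2)) sums (t * cos t / sin t - 1)"
    by (simp add: g_def)
  hence "g sums (t * cos t / sin t - 1)"
  proof (subst (asm) sums_mono_reindex)
    show "strict_mono (\<lambda>m::nat. 2 * m + 2)" by (auto simp: strict_mono_def)
    fix n assume "n \<notin> range (\<lambda>m::nat. 2 * m + 2)"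
    moreover have "n = 2 * (n div 2 - 1) + 2" if "n \<noteq> 0" "even n"
      using that by (elim evenE) auto
    ultimately have "n = 0 \<or> odd n" by blast
    thus "g n = 0" by (auto simp: g_def x_cot_coeff_def)
  qed
  from sums_add[OF this sums_single[of 0 "\<lambda>n. x_cot_coeff n * t^n"]]
  have "(\<lambda>n. g n + (if n = 0 then x_cot_coeff n * t^n else 0)) sums (t * cos t / sin t)"
    by (simp add: x_cot_coeff_def)
  moreover have "g n + (if n = 0 then x_cot_coeff n * t^n else 0) = x_cot_coeff n * t^n" for n
    by (simp add: g_def)
  ultimately show ?thesis using False by (simp add: x_cot_def)
qed

lemma x_cot_has_fps_expansion_coeff: "x_cot has_fps_expansion Abs_fps x_cot_coeff"
proof (rule has_fps_expansionI)
  have "eventually (\<lambda>u::real. u \<in> ball 0 pi) (nhds 0)"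
    by (intro eventually_nhds_in_open) auto
  thus "eventually (\<lambda>u. (\<lambda>n. fps_nth (Abs_fps x_cot_coeff) n * u ^ n) sums x_cot u) (nhds 0)"
    by eventually_elim (simp add: x_cot_coeff_sums)
qed

section \<open>Bernoulli numbers and \<open>\<zeta>(2m)\<close>\<close>

definition riccati_coeffs :: "(nat \<Rightarrow> real) \<Rightarrow> real \<Rightarrow> bool" where
  "riccati_coeffs h k \<longleftrightarrow> h 0 = 1 \<and>
     (\<forall>n\<ge>1. (real n + 1) * h n = - (\<Sum>i=1..n-1. h i * h (n - i)) + (if n = 2 then k else 0))"

lemma riccati_coeffsI:
  fixes H :: "real fps"
  assumes ode: "fps_X * fps_deriv H = H - H^2 + fps_const k * fps_X^2" and H0: "fps_nth H 0 = 1"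
  shows "riccati_coeffs (fps_nth H) k"
  unfolding riccati_coeffs_def
proof (intro conjI allI impI H0)
  fix n :: nat
  assume n: "n \<ge> 1"
  have "fps_nth (H^2) n = (\<Sum>i=0..n. fps_nth H i * fps_nth H (n - i))"
    by (simp add: power2_eq_square fps_mult_nth)
  moreover have "fps_nth (fps_const k * fps_X^2) n = (if n = 2 then k else 0)"
    by (simp add: fps_mult_left_const_nth fps_X_power_nth)
  moreover have "real n * fps_nth H n = fps_nth (fps_X * fps_deriv H) n"
    by (simp add: fps_mult_fps_X_deriv_shift)
  ultimately have "real n * fps_nth H n
      = fps_nth H n - (\<Sum>i=0..n. fps_nth H i * fps_nth H (n - i)) + (if n = 2 then k else 0)"
    unfolding ode by simp
  also have "(\<Sum>i=0..n. fps_nth H i * fps_nth H (n - i))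
      = (\<Sum>i=1..n-1. fps_nth H i * fps_nth H (n - i)) + 2 * fps_nth H n"
    using n H0 by (cases n) (simp_all add: sum.atLeast_Suc_atMost sum.cl_ivl_Suc)
  finally show "(real n + 1) * fps_nth H n
      = - (\<Sum>i=1..n-1. fps_nth H i * fps_nth H (n - i)) + (if n = 2 then k else 0)"
    by (simp add: algebra_simps)
qed

lemma riccati_coeffs_unique:
  assumes "riccati_coeffs h k" "riccati_coeffs g k"
  shows "h n = g n"
proof (induction n rule: less_induct)
  case (less n)
  show ?case
  proof (cases "n = 0")
    case True
    thus ?thesis using assms by (simp add: riccati_coeffs_def)
  next
    case False
    have "(\<Sum>i=1..n-1. h i * h (n - i)) = (\<Sum>i=1..n-1. g i * g (n - i))"
      using False less.IH by (intro sum.cong) auto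
    with assms False have "(real n + 1) * h n = (real n + 1) * g n"
      by (simp add: riccati_coeffs_def)
    thus ?thesis using of_nat_0_le_iff[of n] by simp
  qed
qed

lemma riccati_coeffs_odd_eq_0:
  assumes "riccati_coeffs h k" "odd n"
  shows "h n = 0"
  using assms(2)
proof (induction n rule: less_induct)
  case (less n)
  have "(\<Sum>i=1..n-1. h i * h (n - i)) = 0"
  proof (intro sum.neutral ballI)
    fix i assume i: "i \<in> {1..n-1}"
    show "h i * h (n - i) = 0"
    proof (cases "odd i")
      case True
      thus ?thesis using i less.IH[of i] by auto
    next
      case False
      hence "odd (n - i)" using less.prems i by auto
      thus ?thesis using i less.IH[of "n - i"] by auto
    qed
  qed
  moreover have "n \<ge> 1" "n \<noteq> 2" using less.prems by (auto intro: Suc_leI odd_pos)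
  ultimately have "(real n + 1) * h n = 0" using assms(1) by (simp add: riccati_coeffs_def)
  thus ?case using of_nat_0_le_iff[of n] by simp
qed

text \<open>If \<open>H(X)\<close> has coefficients \<open>c\<close> with vanishing odd part, then \<open>H(2iX)\<close> has the
  real coefficients \<open>scale_by_2i c\<close>.\<close>
definition scale_by_2i :: "(nat \<Rightarrow> real) \<Rightarrow> nat \<Rightarrow> real" where
  "scale_by_2i c n = (if even n then c n * (-4) ^ (n div 2) else 0)"

lemma riccati_coeffs_scale_by_2i:
  assumes c: "riccati_coeffs c k"
  shows "riccati_coeffs (scale_by_2i c) (- 4 * k)"
  unfolding riccati_coeffs_def
proof (intro conjI allI impI)
  show "scale_by_2i c 0 = 1" using c by (simp add: riccati_coeffs_def scale_by_2i_def)
next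
  fix n :: nat
  assume n: "n \<ge> 1"
  show "(real n + 1) * scale_by_2i c n
      = - (\<Sum>i=1..n-1. scale_by_2i c i * scale_by_2i c (n - i)) + (if n = 2 then - 4 * k else 0)"
  proof (cases "even n")
    case True
    have scaled_sum: "(\<Sum>i=1..n-1. scale_by_2i c i * scale_by_2i c (n - i))
        = (-4) ^ (n div 2) * (\<Sum>i=1..n-1. c i * c (n - i))"
      unfolding sum_distrib_left
    proof (intro sum.cong refl)
      fix i assume i: "i \<in> {1..n-1}"
      show "scale_by_2i c i * scale_by_2i c (n - i) = (-4) ^ (n div 2) * (c i * c (n - i))"
      proof (cases "even i")
        case True
        hence "n div 2 = i div 2 + (n - i) div 2" using \<open>even n\<close> i by (elim evenE) auto
        thus ?thesis using True \<open>even n\<close> i by (simp add: scale_by_2i_def power_add)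
      next
        case False
        thus ?thesis by (simp add: scale_by_2i_def riccati_coeffs_odd_eq_0[OF c])
      qed
    qed
    have "(real n + 1) * scale_by_2i c n = (-4) ^ (n div 2) * ((real n + 1) * c n)"
      using True by (simp add: scale_by_2i_def)
    also have "\<dots> = (-4) ^ (n div 2) * (- (\<Sum>i=1..n-1. c i * c (n - i)) + (if n = 2 then k else 0))"
      using c n by (simp add: riccati_coeffs_def)
    also have "\<dots> = - (\<Sum>i=1..n-1. scale_by_2i c i * scale_by_2i c (n - i)) + (if n = 2 then - 4 * k else 0)"
      unfolding scaled_sum by (auto simp: algebra_simps)
    finally show ?thesis .
  next
    case False
    have "(\<Sum>i=1..n-1. scale_by_2i c i * scale_by_2i c (n - i)) = 0"
      using False by (intro sum.neutral) (auto simp: scale_by_2i_def)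
    thus ?thesis using False by (auto simp: scale_by_2i_def)
  qed
qed

definition bernoulli_fps :: "real fps" where
  "bernoulli_fps = fps_X / (fps_exp 1 - 1)"

text \<open>\<open>X/2 \<cdot> coth (X/2)\<close>, an even series.\<close>
definition half_coth_fps :: "real fps" where
  "half_coth_fps = bernoulli_fps + fps_const (1/2) * fps_X"

definition x_cot_fps :: "real fps" where
  "x_cot_fps = fps_X * fps_cos 1 / fps_sin 1"

lemma fps_exp_minus_1_nonzero: "fps_exp (1::real) - 1 \<noteq> 0"
proof
  assume "fps_exp (1::real) - 1 = 0"
  hence "fps_nth (fps_exp (1::real) - 1) 1 = 0" by simp
  thus False by simp
qed

lemma subdegree_fps_exp_minus_1: "subdegree (fps_exp (1::real) - 1) = 1"
  by (rule subdegreeI) auto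

lemma bernoulli_fps_times: "bernoulli_fps * (fps_exp 1 - 1) = fps_X"
  unfolding bernoulli_fps_def using fps_exp_minus_1_nonzero subdegree_fps_exp_minus_1
  by (intro fps_times_divide_eq) auto

lemma bernoulli_fps_nth_0: "fps_nth bernoulli_fps 0 = 1"
proof -
  have "fps_nth (bernoulli_fps * (fps_exp 1 - 1)) 1 = 1" by (simp add: bernoulli_fps_times)
  thus ?thesis by (simp add: fps_mult_nth)
qed

lemma bernoulli_fps_ode:
  "fps_X * fps_deriv bernoulli_fps = bernoulli_fps - bernoulli_fps^2 - fps_X * bernoulli_fps"
proof -
  define B where "B = bernoulli_fps"
  define e where "e = fps_exp (1::real) - 1"
  have X: "fps_X = B * e" using bernoulli_fps_times by (simp add: B_def e_def)
  have "fps_deriv (B * e) = fps_deriv fps_X" using X by simp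
  hence D: "fps_deriv B * e + B * (e + 1) = 1" by (simp add: e_def algebra_simps)
  have "e * (fps_X * fps_deriv B - (B - B^2 - fps_X * B)) = B * e * (fps_deriv B * e + B * (e + 1) - 1)"
    unfolding X by algebra
  also have "\<dots> = 0" by (simp add: D)
  finally show ?thesis using fps_exp_minus_1_nonzero by (simp add: B_def e_def)
qed

lemma riccati_coeffs_half_coth_fps: "riccati_coeffs (fps_nth half_coth_fps) (1/4)"
proof (rule riccati_coeffsI)
  have quarter: "fps_const (1/4::real) = fps_const (1/2) * fps_const (1/2)"
    and halves: "fps_const (1/2::real) + fps_const (1/2) = 1"
    by (simp_all flip: fps_const_mult fps_const_add)
  have "fps_X * fps_deriv half_coth_fps = fps_X * fps_deriv bernoulli_fps + fps_const (1/2) * fps_X"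
    by (simp add: half_coth_fps_def algebra_simps)
  thus "fps_X * fps_deriv half_coth_fps
      = half_coth_fps - half_coth_fps^2 + fps_const (1/4) * fps_X^2"
    unfolding bernoulli_fps_ode quarter half_coth_fps_def using halves by algebra
  show "fps_nth half_coth_fps 0 = 1" by (simp add: half_coth_fps_def bernoulli_fps_nth_0)
qed

lemma fps_sin_1_nonzero: "fps_sin (1::real) \<noteq> 0"
proof
  assume "fps_sin (1::real) = 0"
  hence "fps_nth (fps_sin (1::real)) 1 = 0" by simp
  thus False by (simp add: fps_sin_def)
qed

lemma subdegree_fps_sin_1: "subdegree (fps_sin (1::real)) = 1"
  by (rule subdegreeI) (auto simp: fps_sin_def)

lemma subdegree_X_times_fps_cos_1: "subdegree (fps_X * fps_cos (1::real)) = 1"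
  by (rule subdegreeI) (auto simp: fps_cos_def)

lemma x_cot_fps_times: "x_cot_fps * fps_sin 1 = fps_X * fps_cos 1"
  unfolding x_cot_fps_def using fps_sin_1_nonzero subdegree_fps_sin_1 subdegree_X_times_fps_cos_1
  by (intro fps_times_divide_eq) auto

lemma riccati_coeffs_x_cot_fps: "riccati_coeffs (fps_nth x_cot_fps) (-1)"
proof (rule riccati_coeffsI)
  define G where "G = x_cot_fps"
  define s where "s = fps_sin (1::real)"
  define c where "c = fps_cos (1::real)"
  have P: "G * s = fps_X * c" using x_cot_fps_times by (simp add: G_def s_def c_def)
  have "fps_deriv (G * s) = fps_deriv (fps_X * c)" using P by simp
  moreover have "fps_const (-1::real) = - 1" by (simp add: fps_eq_iff)
  ultimately have D: "fps_deriv G * s + G * c = c - fps_X * s"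
    by (simp add: s_def c_def fps_sin_deriv fps_cos_deriv algebra_simps)
  have "s * (fps_X * fps_deriv G - (G - G^2 - fps_X^2))
      = fps_X * (fps_deriv G * s + G * c) - fps_X * G * c - G * s + G * (G * s) + fps_X^2 * s"
    by algebra
  also have "\<dots> = 0" unfolding D P by algebra
  finally have "fps_X * fps_deriv G = G - G^2 - fps_X^2"
    using fps_sin_1_nonzero by (simp add: s_def)
  thus "fps_X * fps_deriv x_cot_fps = x_cot_fps - x_cot_fps^2 + fps_const (-1) * fps_X^2"
    by (simp add: G_def fps_eq_iff)
  have "fps_nth (x_cot_fps * fps_sin 1) 1 = fps_nth (fps_X * fps_cos (1::real)) 1"
    by (simp add: x_cot_fps_times)
  thus "fps_nth x_cot_fps 0 = 1" by (simp add: fps_mult_nth fps_sin_def fps_cos_def)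
qed

lemma fps_nth_x_cot_fps_eq_bernoulli:
  assumes "m \<ge> 1"
  shows "fps_nth x_cot_fps (2 * m) = (-4)^m * bernoulli (2 * m) / fact (2 * m)"
proof -
  have "fps_nth x_cot_fps n = scale_by_2i (fps_nth half_coth_fps) n" for n
    using riccati_coeffs_unique riccati_coeffs_x_cot_fps
      riccati_coeffs_scale_by_2i[OF riccati_coeffs_half_coth_fps] by simp
  moreover have "fps_nth half_coth_fps (2 * m) = fps_nth bernoulli_fps (2 * m)"
    using assms by (simp add: half_coth_fps_def)
  ultimately show ?thesis by (simp add: scale_by_2i_def bernoulli_def bernoulli_fps_def)
qed

lemma x_cot_has_fps_expansion: "x_cot has_fps_expansion x_cot_fps"
proof -
  have expansion: "(\<lambda>x. if x = 0 then fps_nth (fps_X * fps_cos 1) (subdegree (fps_sin (1::real)))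
                             / fps_nth (fps_sin 1) (subdegree (fps_sin (1::real)))
             else x * cos x / sin x) has_fps_expansion x_cot_fps"
    unfolding x_cot_fps_def
    by (intro has_fps_expansion_divide has_fps_expansion_mult has_fps_expansion_fps_X
        has_fps_expansion_cos' has_fps_expansion_sin')
       (use subdegree_X_times_fps_cos_1 subdegree_fps_sin_1 fps_sin_1_nonzero in auto)
  have at_0: "fps_nth (fps_X * fps_cos 1) (subdegree (fps_sin (1::real)))
      / fps_nth (fps_sin 1) (subdegree (fps_sin (1::real))) = 1"
    unfolding subdegree_fps_sin_1 by (simp add: fps_sin_def fps_cos_def)
  show ?thesis using expansion unfolding at_0 by (simp add: x_cot_def[abs_def])
qed

lemma abs_bernoulli_eq_zeta:
  assumes "m \<ge> 1"
  shows "\<bar>bernoulli (2 * m)\<bar> = 2 * fact (2 * m) * zeta (2 * m) / (4^m * pi^(2 * m))"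
proof -
  have "x_cot_coeff (2 * m) = fps_nth x_cot_fps (2 * m)"
    using has_fps_expansion_unique[OF x_cot_has_fps_expansion_coeff x_cot_has_fps_expansion]
    by (metis fps_nth_Abs_fps)
  hence "(-4)^m * bernoulli (2 * m) / fact (2 * m) = - (2 * zeta (2 * m) / pi^(2 * m))"
    using fps_nth_x_cot_fps_eq_bernoulli[OF assms] assms by (simp add: x_cot_coeff_def)
  hence "\<bar>(-4)^m * bernoulli (2 * m) / fact (2 * m)\<bar> = \<bar>2 * zeta (2 * m) / pi^(2 * m)\<bar>"
    by simp
  hence "4^m * \<bar>bernoulli (2 * m)\<bar> / fact (2 * m) = 2 * zeta (2 * m) / pi^(2 * m)"
    using zeta_pos[of "2 * m"] assms by (simp add: abs_mult power_abs)
  thus ?thesis by (simp add: field_simps)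
qed

lemma bernoulli_coeff_eq_zeta:
  "real j * 2^(2 * j + 3) * \<bar>bernoulli (2 * j + 2)\<bar> / fact (2 * j + 2)
     = 4 * real j * zeta (2 * j + 2) / pi^(2 * j + 2)"
proof -
  have "\<bar>bernoulli (2 * j + 2)\<bar> = 2 * fact (2 * j + 2) * zeta (2 * j + 2) / (4^(j + 1) * pi^(2 * j + 2))"
    using abs_bernoulli_eq_zeta[of "j + 1"] by (simp add: algebra_simps)
  moreover have "(2::real)^(2 * j + 3) = 2 * 4^(j + 1)"
    by (simp add: power_add power_mult)
  ultimately show ?thesis by simp
qed

section \<open>A positive series for \<open>F_N\<close>\<close>

definition remainder_weight :: "nat \<Rightarrow> real \<Rightarrow> real" where
  "remainder_weight N u = 4 / (1 - u)^2 + 4 * (real N - 1) / (1 - u)"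

text \<open>\<open>4u\<^sup>2/(1 - u)\<^sup>2 = \<Sum>\<^sub>j\<^sub>\<ge>\<^sub>1 4j u\<^bsup>j+1\<^esup>\<close>; this is its tail after \<open>M\<close> terms.\<close>
lemma remainder_weight_tail:
  fixes u :: real
  assumes "u \<noteq> 1"
  shows "4 * u^2 / (1 - u)^2 - (\<Sum>j=1..M. 4 * real j * u^(j + 1)) = u^(M + 2) * remainder_weight (Suc M) u"
proof (induction M)
  case 0
  thus ?case by (simp add: remainder_weight_def power2_eq_square)
next
  case (Suc M)
  have "remainder_weight (Suc M) u - 4 * real (Suc M) = u * remainder_weight (Suc (Suc M)) u"
    using assms unfolding remainder_weight_def
    by (simp add: field_simps) (simp add: algebra_simps power2_eq_square)
  with Suc.IH show ?case
    by (simp add: sum.cl_ivl_Suc algebra_simps)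
qed

lemma F_N_sums:
  assumes N: "N \<ge> 1" and x: "0 < x" "x < 1"
  shows "(\<lambda>k. (x^2 / (real k + 1)^2)^(N + 1) * remainder_weight N (x^2 / (real k + 1)^2)) sums F_N N (pi * x)"
proof -
  obtain M where M: "N = Suc M" using N by (cases N) auto
  define u where "u k = x^2 / (real k + 1)^2" for k
  have x_less: "x^2 < (real k + 1)^2" for k
    using x by (intro power_strict_mono) auto
  have "4 * x^4 / ((real k + 1)^2 - x^2)^2 = 4 * (u k)^2 / (1 - u k)^2" for k
  proof -
    have "u k / (1 - u k) = x^2 / ((real k + 1)^2 - x^2)"
      using x_less[of k] by (simp add: u_def field_simps)
    hence "4 * (u k)^2 / (1 - u k)^2 = 4 * (x^2 / ((real k + 1)^2 - x^2))^2"
      by (metis power_divide times_divide_eq_right)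
    thus ?thesis by (simp add: power_divide flip: power_mult)
  qed
  hence total: "(\<lambda>k. 4 * (u k)^2 / (1 - u k)^2) sums ((pi * x / sin (pi * x))^2 + pi * x / tan (pi * x) - 2)"
    using csc_squared_plus_cot_sums[OF x] by simp
  have "(\<lambda>k. 4 * real j * (u k)^(j + 1)) sums (4 * real j * zeta (2 * j + 2) * x^(2 * j + 2))" for j
    using scaled_zeta_sums[of "j + 1" "4 * real j" x] by (simp add: u_def)
  moreover have "4 * real j * zeta (2 * j + 2) * x^(2 * j + 2)
      = real j * 2^(2 * j + 3) * \<bar>bernoulli (2 * j + 2)\<bar> / fact (2 * j + 2) * (pi * x)^(2 * j + 2)" for j
    unfolding bernoulli_coeff_eq_zeta by (simp add: power_mult_distrib)
  ultimately have "(\<lambda>k. \<Sum>j=1..M. 4 * real j * (u k)^(j + 1)) sums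
      (\<Sum>j=1..M. real j * 2^(2 * j + 3) * \<bar>bernoulli (2 * j + 2)\<bar> / fact (2 * j + 2) * (pi * x)^(2 * j + 2))"
    by (intro sums_sum) metis
  from sums_diff[OF total this]
  have "(\<lambda>k. 4 * (u k)^2 / (1 - u k)^2 - (\<Sum>j=1..M. 4 * real j * (u k)^(j + 1))) sums F_N N (pi * x)"
    by (simp add: F_N_def M tan_def diff_diff_eq)
  moreover have "4 * (u k)^2 / (1 - u k)^2 - (\<Sum>j=1..M. 4 * real j * (u k)^(j + 1))
      = (u k)^(N + 1) * remainder_weight N (u k)" for k
    using remainder_weight_tail[of "u k" M] x_less[of k] by (simp add: u_def M)
  ultimately have "(\<lambda>k. (u k)^(N + 1) * remainder_weight N (u k)) sums F_N N (pi * x)"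
    by simp
  thus ?thesis by (simp only: u_def)
qed

lemma F_N_div_power_sums:
  assumes N: "N \<ge> 1" and x: "0 < x" "x < 1"
  shows "(\<lambda>k. remainder_weight N (x^2 / (real k + 1)^2) / (real k + 1)^(2 * N + 2))
           sums (F_N N (pi * x) / x^(2 * N + 2))"
proof -
  have "2 * N + 2 = 2 * (N + 1)" by simp
  hence "(x^2 / (real k + 1)^2)^(N + 1) = x^(2 * N + 2) / (real k + 1)^(2 * N + 2)" for k
    by (simp only: power_divide power_mult)
  hence "(x^2 / (real k + 1)^2)^(N + 1) * w / x^(2 * N + 2) = w / (real k + 1)^(2 * N + 2)" for k w
    using x by simp
  thus ?thesis
    using sums_divide[OF F_N_sums[OF N x], of "x^(2 * N + 2)"] by simp
qed

lemma remainder_weight_gt: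
  assumes "N \<ge> 1" "0 < u" "u < 1"
  shows "4 * real N < remainder_weight N u"
proof -
  have "1 < 1 / (1 - u)^2" "1 \<le> 1 / (1 - u)"
    using assms by (simp_all add: power_less_one_iff)
  hence "4 < 4 / (1 - u)^2" "4 * (real N - 1) \<le> 4 * (real N - 1) / (1 - u)"
    using assms by (auto simp: field_simps intro!: mult_left_mono)
  thus ?thesis by (simp add: remainder_weight_def)
qed

lemma remainder_weight_strict_mono:
  assumes "N \<ge> 1" "u < v" "v < 1"
  shows "remainder_weight N u < remainder_weight N v"
proof -
  have "4 / (1 - u)^2 < 4 / (1 - v)^2"
    using assms by (intro divide_strict_left_mono power_strict_mono) auto
  moreover have "4 * (real N - 1) / (1 - u) \<le> 4 * (real N - 1) / (1 - v)"
    using assms by (intro divide_left_mono) auto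
  ultimately show ?thesis by (simp add: remainder_weight_def)
qed

lemma remainder_weight_le:
  assumes "N \<ge> 1" "0 \<le> u" "u \<le> 1/4"
  shows "remainder_weight N u \<le> 4 * real N + 8 * (real N + 1) * u"
proof -
  have "1 \<le> (1 + 4 * u) * (1 - u)^2"
  proof -
    have "(1 + 4 * u) * (1 - u)^2 = 1 + u * (2 - 7 * u + 4 * u^2)"
      by (simp add: algebra_simps power2_eq_square)
    moreover have "2 - 7 * u + 4 * u^2 \<ge> 0" using assms zero_le_power2[of u] by linarith
    ultimately show ?thesis using assms by simp
  qed
  hence "4 / (1 - u)^2 \<le> 4 * (1 + 4 * u)"
    using assms by (simp add: field_simps)
  moreover have "u * (1 - 2 * u) \<ge> 0"
    using assms by (intro mult_nonneg_nonneg) auto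
  hence "1 / (1 - u) \<le> 1 + 2 * u"
    using assms by (simp add: field_simps algebra_simps)
  hence "4 * (real N - 1) * (1 / (1 - u)) \<le> 4 * (real N - 1) * (1 + 2 * u)"
    using assms by (intro mult_left_mono) auto
  ultimately show ?thesis unfolding remainder_weight_def by (simp add: algebra_simps diff_divide_distrib)
qed

lemma lambda_N_eq_zeta: "lambda_N N * pi^(2 * N + 2) = 4 * real N * zeta (2 * N + 2)"
  unfolding lambda_N_def bernoulli_coeff_eq_zeta by simp

lemma F_N_div_power_gt_lambda_N:
  assumes N: "N \<ge> 1" and x: "0 < x" "x < 1"
  shows "lambda_N N * pi^(2 * N + 2) < F_N N (pi * x) / x^(2 * N + 2)"
proof (rule sums_less)
  show "(\<lambda>k. 4 * real N * (1 / (real k + 1)^(2 * N + 2))) sums (lambda_N N * pi^(2 * N + 2))"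
    unfolding lambda_N_eq_zeta by (intro sums_mult zeta_sums) auto
  show "(\<lambda>k. remainder_weight N (x^2 / (real k + 1)^2) / (real k + 1)^(2 * N + 2))
          sums (F_N N (pi * x) / x^(2 * N + 2))"
    by (rule F_N_div_power_sums[OF N x])
  fix k
  have "x^2 < (real k + 1)^2" using x by (intro power_strict_mono) auto
  hence "4 * real N < remainder_weight N (x^2 / (real k + 1)^2)"
    using x by (intro remainder_weight_gt N) auto
  thus "4 * real N * (1 / (real k + 1)^(2 * N + 2))
      < remainder_weight N (x^2 / (real k + 1)^2) / (real k + 1)^(2 * N + 2)"
    by (simp add: divide_strict_right_mono)
qed

lemma F_N_div_power_strict_mono:
  assumes N: "N \<ge> 1" and xy: "0 < x" "x < y" "y < 1"
  shows "F_N N (pi * x) / x^(2 * N + 2) < F_N N (pi * y) / y^(2 * N + 2)"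
proof (rule sums_less[OF F_N_div_power_sums F_N_div_power_sums])
  fix k
  have "x^2 < y^2" "y^2 < (real k + 1)^2"
    using xy by (auto intro: power_strict_mono)
  hence "remainder_weight N (x^2 / (real k + 1)^2) < remainder_weight N (y^2 / (real k + 1)^2)"
    by (intro remainder_weight_strict_mono N) (auto simp: divide_strict_right_mono)
  thus "remainder_weight N (x^2 / (real k + 1)^2) / (real k + 1)^(2 * N + 2)
      < remainder_weight N (y^2 / (real k + 1)^2) / (real k + 1)^(2 * N + 2)"
    by (simp add: divide_strict_right_mono)
qed (use N xy in auto)

lemma F_N_div_power_le:
  assumes N: "N \<ge> 1" and x: "0 < x" "x \<le> 1/2"
  shows "F_N N (pi * x) / x^(2 * N + 2) \<le> lambda_N N * pi^(2 * N + 2) + 8 * (real N + 1) * zeta (2 * N + 2) * x^2"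
proof (rule sums_le)
  define C where "C = 4 * real N + 8 * (real N + 1) * x^2"
  show "(\<lambda>k. C * (1 / (real k + 1)^(2 * N + 2))) sums
          (lambda_N N * pi^(2 * N + 2) + 8 * (real N + 1) * zeta (2 * N + 2) * x^2)"
  proof -
    have "(\<lambda>k. C * (1 / (real k + 1)^(2 * N + 2))) sums (C * zeta (2 * N + 2))"
      by (intro sums_mult zeta_sums) auto
    also have "C * zeta (2 * N + 2) = lambda_N N * pi^(2 * N + 2) + 8 * (real N + 1) * zeta (2 * N + 2) * x^2"
      unfolding lambda_N_eq_zeta C_def by (simp add: algebra_simps)
    finally show ?thesis .
  qed
  show "(\<lambda>k. remainder_weight N (x^2 / (real k + 1)^2) / (real k + 1)^(2 * N + 2))
          sums (F_N N (pi * x) / x^(2 * N + 2))"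
    using x by (intro F_N_div_power_sums N) auto
  fix k
  have "x^2 \<le> 1/4" using x power_mono[of x "1/2" 2] by (simp add: power2_eq_square)
  moreover have "x^2 / (real k + 1)^2 \<le> x^2 / 1"
    by (intro divide_left_mono) auto
  ultimately have "x^2 / (real k + 1)^2 \<le> 1/4" by linarith
  hence "remainder_weight N (x^2 / (real k + 1)^2) \<le> 4 * real N + 8 * (real N + 1) * (x^2 / (real k + 1)^2)"
    by (intro remainder_weight_le N) auto
  also have "\<dots> \<le> C"
    unfolding C_def using \<open>x^2 / (real k + 1)^2 \<le> x^2 / 1\<close> by (intro add_left_mono mult_left_mono) auto
  finally show "remainder_weight N (x^2 / (real k + 1)^2) / (real k + 1)^(2 * N + 2)
      \<le> C * (1 / (real k + 1)^(2 * N + 2))"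
    by (simp add: divide_right_mono)
qed

lemma remainder_weight_quarter_div_power:
  fixes K :: real
  assumes N: "N \<ge> 1" and K: "K \<ge> 1"
  shows "remainder_weight N (1 / (4 * K^2)) / K^(2 * N + 2)
       = 64 * real N / (K^(2 * N - 2) * (4 * K^2 - 1)^2) - 16 * (real N - 1) / (K^(2 * N) * (4 * K^2 - 1)^2)"
proof -
  obtain M where M: "N = Suc M" using N by (cases N) auto
  define P where "P = K^(2 * M)"
  define D where "D = 4 * K^2 - 1"
  have "K^2 \<ge> 1" using K by (simp add: one_le_power)
  hence "D > 0" unfolding D_def by linarith
  hence pos: "D > 0" "P > 0" "K > 0" using K by (simp_all add: P_def)
  have powers: "K^(2 * N - 2) = P" "K^(2 * N) = P * K^2" "K^(2 * N + 2) = P * K^2 * K^2"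
    by (simp_all add: M P_def flip: power_add)
  have "1 - 1 / (4 * K^2) = D / (4 * K^2)"
    using pos by (simp add: D_def field_simps)
  hence "remainder_weight N (1 / (4 * K^2)) = 64 * K^4 / D^2 + 16 * (real M * K^2) / D"
    using pos by (simp add: remainder_weight_def M power_divide power_mult_distrib)
  moreover have "(64 * K^4 / D^2 + 16 * (real M * K^2) / D) / (P * K^2 * K^2)
      = 64 / (P * D^2) + 16 * real M / (P * K^2 * D)"
    using pos by (simp add: field_simps power2_eq_square power4_eq_xxxx)
  moreover have "64 * (real M + 1) / (P * D^2) - 16 * real M / (P * K^2 * D^2)
      - (64 / (P * D^2) + 16 * real M / (P * K^2 * D)) = 16 * real M * (4 * K^2 - 1 - D) / (P * K^2 * D^2)"
    using pos by (simp add: field_simps power2_eq_square)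
  ultimately show ?thesis
    unfolding powers by (simp add: M D_def[symmetric] add_ac)
qed

lemma summable_inverse_power_times_square:
  "summable (\<lambda>k. 1 / (real (Suc k)^p * (4 * real (Suc k)^2 - 1)^2))"
proof (rule summable_comparison_test')
  show "summable (\<lambda>k. 1 / (real k + 1)^2)" using zeta_sums[of 2] by (simp add: sums_iff)
  fix k
  define K where "K = real (Suc k)"
  have "K \<ge> 1" by (simp add: K_def)
  moreover have "K \<le> K^2"
    using mult_right_mono[OF \<open>K \<ge> 1\<close>, of K] \<open>K \<ge> 1\<close> by (simp add: power2_eq_square)
  ultimately have "4 * K^2 - 1 \<ge> K" by linarith
  hence "1 * K^2 \<le> K^p * (4 * K^2 - 1)^2"
    using \<open>K \<ge> 1\<close> by (intro mult_mono power_mono one_le_power) auto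
  hence "1 / (K^p * (4 * K^2 - 1)^2) \<le> 1 / K^2"
    using \<open>K \<ge> 1\<close> \<open>4 * K^2 - 1 \<ge> K\<close> by (intro divide_left_mono) auto
  thus "norm (1 / (real (Suc k)^p * (4 * real (Suc k)^2 - 1)^2)) \<le> 1 / (real k + 1)^2"
    using \<open>K \<ge> 1\<close> by (simp add: K_def add.commute)
qed

lemma F_N_half:
  assumes N: "N \<ge> 1"
  shows "F_N N (pi / 2) = mu_N N * (pi / 2)^(2 * N + 2)"
proof -
  define S where "S p = (\<Sum>k. 1 / (real (Suc k)^p * (4 * real (Suc k)^2 - 1)^2))" for p
  have "(\<lambda>k. 64 * real N * (1 / (real (Suc k)^(2 * N - 2) * (4 * real (Suc k)^2 - 1)^2))
          - 16 * (real N - 1) * (1 / (real (Suc k)^(2 * N) * (4 * real (Suc k)^2 - 1)^2)))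
        sums (64 * real N * S (2 * N - 2) - 16 * (real N - 1) * S (2 * N))"
    unfolding S_def by (intro sums_diff sums_mult summable_sums summable_inverse_power_times_square)
  moreover have "(1/2)^2 / (real k + 1)^2 = 1 / (4 * real (Suc k)^2)" for k
    by (simp add: power_divide add.commute)
  ultimately have "(\<lambda>k. remainder_weight N ((1/2)^2 / (real k + 1)^2) / (real k + 1)^(2 * N + 2))
      sums (64 * real N * S (2 * N - 2) - 16 * (real N - 1) * S (2 * N))"
    using remainder_weight_quarter_div_power[OF N] by (simp add: add.commute)
  moreover have "(\<lambda>k. remainder_weight N ((1/2)^2 / (real k + 1)^2) / (real k + 1)^(2 * N + 2))
      sums (F_N N (pi * (1/2)) / (1/2)^(2 * N + 2))"
    by (rule F_N_div_power_sums[OF N]) auto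
  ultimately have "F_N N (pi / 2) / (1/2)^(2 * N + 2) = 64 * real N * S (2 * N - 2) - 16 * (real N - 1) * S (2 * N)"
    using sums_unique2 by simp
  also have "\<dots> = mu_N N * pi^(2 * N + 2)"
  proof -
    have "mu_N N = 64 * real N / pi^(2 * N + 2) * S (2 * N - 2) - 16 * (real N - 1) / pi^(2 * N + 2) * S (2 * N)"
      by (simp only: mu_N_def S_def)
    thus ?thesis by (simp add: field_simps)
  qed
  finally have "F_N N (pi / 2) = mu_N N * pi^(2 * N + 2) * (1/2)^(2 * N + 2)"
    by (simp add: divide_eq_eq)
  thus ?thesis by (simp add: power_divide)
qed

section \<open>The bounds and their optimality\<close>

lemma F_N_lower_bound:
  assumes "N \<ge> 1" "0 < t" "t < pi"
  shows "lambda_N N * t^(2 * N + 2) < F_N N t"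
proof -
  have "lambda_N N * pi^(2 * N + 2) < F_N N (pi * (t / pi)) / (t / pi)^(2 * N + 2)"
    using assms by (intro F_N_div_power_gt_lambda_N) auto
  thus ?thesis using assms by (simp add: power_divide field_simps)
qed

lemma F_N_upper_bound:
  assumes "N \<ge> 1" "0 < t" "t < pi / 2"
  shows "F_N N t < mu_N N * t^(2 * N + 2)"
proof -
  have "F_N N (pi * (t / pi)) / (t / pi)^(2 * N + 2) < F_N N (pi * (1/2)) / (1/2)^(2 * N + 2)"
    using assms by (intro F_N_div_power_strict_mono) auto
  also have "\<dots> = mu_N N * pi^(2 * N + 2)"
    using F_N_half[OF assms(1)] by (simp add: power_divide)
  finally show ?thesis using assms by (simp add: power_divide field_simps)
qed

lemma lambda_N_optimal:
  assumes N: "N \<ge> 1"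
    and below: "\<And>t. 0 < t \<Longrightarrow> t < pi / 2 \<Longrightarrow> c * t^(2 * N + 2) \<le> F_N N t"
  shows "c \<le> lambda_N N"
proof -
  define C where "C = 8 * (real N + 1) * zeta (2 * N + 2)"
  have "c * pi^(2 * N + 2) \<le> lambda_N N * pi^(2 * N + 2) + C * x^2" if "0 < x" "x < 1/2" for x
  proof -
    have "c * pi^(2 * N + 2) \<le> F_N N (pi * x) / x^(2 * N + 2)"
      using below[of "pi * x"] that by (simp add: field_simps power_mult_distrib)
    also have "\<dots> \<le> lambda_N N * pi^(2 * N + 2) + C * x^2"
      unfolding C_def using that by (intro F_N_div_power_le N) auto
    finally show ?thesis .
  qed
  hence "eventually (\<lambda>x. c * pi^(2 * N + 2) \<le> lambda_N N * pi^(2 * N + 2) + C * x^2) (at_right 0)"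
    using eventually_at_right_real[of 0 "1/2"] by (auto elim: eventually_mono)
  moreover have "((\<lambda>x. lambda_N N * pi^(2 * N + 2) + C * x^2) \<longlongrightarrow> lambda_N N * pi^(2 * N + 2))
      (at_right 0)"
    by (auto intro!: tendsto_eq_intros)
  ultimately have "c * pi^(2 * N + 2) \<le> lambda_N N * pi^(2 * N + 2)"
    by (intro tendsto_le[OF _ _ tendsto_const]) auto
  thus ?thesis by simp
qed

lemma mu_N_optimal:
  assumes N: "N \<ge> 1"
    and above: "\<And>t. 0 < t \<Longrightarrow> t < pi / 2 \<Longrightarrow> F_N N t \<le> c * t^(2 * N + 2)"
  shows "mu_N N \<le> c"
proof -
  \<comment> \<open>valid also where \<open>cos t = 0\<close>, since then both sides of \<open>t / tan t = t cos t / sin t\<close> are \<open>0\<close>\<close>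
  have F_N_cot: "F_N N = (\<lambda>t. (t / sin t)^2 + t * cos t / sin t
      - (2 + (\<Sum>j=1..N-1. real j * 2^(2*j+3) * \<bar>bernoulli (2*j+2)\<bar> / fact (2*j+2) * t^(2*j+2))))"
    by (auto simp: F_N_def tan_def)
  have "isCont (F_N N) (pi / 2)"
    unfolding F_N_cot by (intro continuous_intros) auto
  hence "(F_N N \<longlongrightarrow> F_N N (pi / 2)) (at_left (pi / 2))"
    by (simp add: isCont_def filterlim_at_split)
  moreover have "((\<lambda>t. c * t^(2 * N + 2)) \<longlongrightarrow> c * (pi / 2)^(2 * N + 2)) (at_left (pi / 2))"
    by (auto intro!: tendsto_eq_intros)
  moreover have "eventually (\<lambda>t. F_N N t \<le> c * t^(2 * N + 2)) (at_left (pi / 2))"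
    using eventually_at_left_real[of 0 "pi / 2"] above by (auto elim: eventually_mono)
  ultimately have "F_N N (pi / 2) \<le> c * (pi / 2)^(2 * N + 2)"
    by (intro tendsto_le[of "at_left (pi / 2)"]) auto
  thus ?thesis using F_N_half[OF N] by simp
qed

theorem theorem6:
  fixes N :: nat
  assumes "N \<ge> 1"
  shows "(\<forall>t::real. 0 < t \<and> t < pi/2 \<longrightarrow>
            lambda_N N * t^(2*N+2) < F_N N t \<and> F_N N t < mu_N N * t^(2*N+2))
       \<and> (\<forall>c::real. (\<forall>t::real. 0 < t \<and> t < pi/2 \<longrightarrow> c * t^(2*N+2) < F_N N t) \<longrightarrow> c \<le> lambda_N N)
       \<and> (\<forall>c::real. (\<forall>t::real. 0 < t \<and> t < pi/2 \<longrightarrow> F_N N t < c * t^(2*N+2)) \<longrightarrow> mu_N N \<le> c)"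
proof (intro conjI allI impI)
  fix t :: real
  assume "0 < t \<and> t < pi/2"
  thus "lambda_N N * t^(2*N+2) < F_N N t" "F_N N t < mu_N N * t^(2*N+2)"
    using assms F_N_lower_bound[of N t] F_N_upper_bound[of N t] by auto
next
  fix c :: real
  assume "\<forall>t::real. 0 < t \<and> t < pi/2 \<longrightarrow> c * t^(2*N+2) < F_N N t"
  thus "c \<le> lambda_N N" by (intro lambda_N_optimal[OF assms]) (simp add: less_imp_le)
next
  fix c :: real
  assume "\<forall>t::real. 0 < t \<and> t < pi/2 \<longrightarrow> F_N N t < c * t^(2*N+2)"
  thus "mu_N N \<le> c" by (intro mu_N_optimal[OF assms]) (simp add: less_imp_le)
qed
end
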